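(* Let $n\ge1$, $p\in\{0,1,2,\dots\}\cup\{+\infty\}$, let $\Omega$ be an open subset of $\mathbb{C}^n$, $L$ a compact subset of $\Omega$ and $G=\Omega\setminus L$. If there is a function $f_0\in A^p(G)$ with no extension in $A^p(\Omega)$ (i.e. there is no $F\in A^p(\Omega)$ with $F=f_0$ on $G$), then the set of all functions in $A^p(G)$ with no extension in $A^p(\Omega)$ is a dense $G_\delta$ subset of $A^p(G)$.
   Context: For an open set $W\subseteq\mathbb{C}^n$, $A^p(W)$ is the set of holomorphic functions $f:W\to\mathbb{C}$ such that $\frac{\partial^{\alpha}f}{\partial z^{\alpha}}$ extends continuously to $\overline{W}$ for every multi-index $\alpha\in\mathbb{N}^n$ with $|\alpha|\le p$ (all $\alpha$ if $p=+\infty$). Its topology is given by the seminorms $|f|_{\alpha,N}=\sup_{z\in\overline{W},\,\|z\|\le N}\left|\frac{\partial^{\alpha}f}{\partial z^{\alpha}}(z)\right|$, $|\alpha|\le p$, $N\in\mathbb{N}$; it is a Fréchet space. *)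

theory Defs
  imports "HOL-Analysis.Analysis" "HOL-Library.Extended_Nat"
begin

definition holomorphic_Cn_on :: "(complex ^ 'n \<Rightarrow> complex) \<Rightarrow> (complex ^ 'n) set \<Rightarrow> bool"
  where "holomorphic_Cn_on f W \<longleftrightarrow>
    (\<forall>z\<in>W. \<exists>D. (f has_derivative D) (at z) \<and> (\<forall>c v. D (c *s v) = c * D v))"

definition cpartial :: "'n \<Rightarrow> (complex ^ 'n \<Rightarrow> complex) \<Rightarrow> complex ^ 'n \<Rightarrow> complex"
  where "cpartial j f z = deriv (\<lambda>w. f (\<chi> i. if i = j then w else z $ i)) (z $ j)"

(* The index type carries no order, so an arbitrary enumeration of the coordinates fixes the
   order of differentiation; partial derivatives of holomorphic functions commute. *)
definition mixed_partial :: "nat ^ 'n \<Rightarrow> (complex ^ 'n \<Rightarrow> complex) \<Rightarrow> complex ^ 'n \<Rightarrow> complex"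
  where "mixed_partial \<alpha> f =
    fold (\<lambda>j. cpartial j ^^ (\<alpha> $ j)) (SOME js. distinct js \<and> set js = UNIV) f"

definition multi_order :: "nat ^ 'n \<Rightarrow> nat"
  where "multi_order \<alpha> = (\<Sum>i\<in>UNIV. \<alpha> $ i)"

definition cont_extension ::
    "(complex ^ 'n) set \<Rightarrow> (complex ^ 'n \<Rightarrow> complex) \<Rightarrow> (complex ^ 'n \<Rightarrow> complex) \<Rightarrow> bool"
  where "cont_extension W h g \<longleftrightarrow> continuous_on (closure W) g \<and> (\<forall>z\<in>W. g z = h z)"

(* A function on W is an element of extensional W, so that equality in A_space
   is equality on W. *)
definition A_space :: "enat \<Rightarrow> (complex ^ 'n) set \<Rightarrow> (complex ^ 'n \<Rightarrow> complex) set"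
  where "A_space p W = {f \<in> extensional W. holomorphic_Cn_on f W \<and>
    (\<forall>\<alpha>. enat (multi_order \<alpha>) \<le> p \<longrightarrow> (\<exists>g. cont_extension W (mixed_partial \<alpha> f) g))}"

(* The choice of the extension is irrelevant: it is unique on closure W. Inserting 0 makes the
   supremum over an empty index set 0 (Sup {} is unspecified on the reals) and changes nothing
   otherwise. *)
definition A_seminorm :: "(complex ^ 'n) set \<Rightarrow> nat ^ 'n \<Rightarrow> nat \<Rightarrow> (complex ^ 'n \<Rightarrow> complex) \<Rightarrow> real"
  where "A_seminorm W \<alpha> N f =
    Sup (insert 0 ((\<lambda>z. cmod ((SOME g. cont_extension W (mixed_partial \<alpha> f) g) z)) `
      {z \<in> closure W. norm z \<le> real N}))"

definition A_topology :: "enat \<Rightarrow> (complex ^ 'n) set \<Rightarrow> (complex ^ 'n \<Rightarrow> complex) topology"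
  where "A_topology p W = topology_generated_by
    {{g \<in> A_space p W. A_seminorm W \<alpha> N (\<lambda>z. g z - f z) < \<epsilon>} | f \<alpha> N \<epsilon>.
      f \<in> A_space p W \<and> enat (multi_order \<alpha>) \<le> p \<and> 0 < \<epsilon>}"

lemma topspace_A_topology: "topspace (A_topology p W) = A_space p W"
proof
  show "topspace (A_topology p W) \<subseteq> A_space p W"
    unfolding A_topology_def topology_generated_by_topspace by blast
  show "A_space p W \<subseteq> topspace (A_topology p W)"
  proof
    fix f assume f: "f \<in> A_space p W"
    define s where "s = A_seminorm W 0 0 (\<lambda>z. f z - f z)"
    let ?B = "{g \<in> A_space p W. A_seminorm W 0 0 (\<lambda>z. g z - f z) < \<bar>s\<bar> + 1}"
    have "f \<in> ?B" using f by (simp add: s_def)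
    moreover have "enat (multi_order (0 :: nat ^ 'a)) \<le> p"
      by (simp add: multi_order_def flip: zero_enat_def)
    moreover have "0 < \<bar>s\<bar> + 1" by simp
    ultimately show "f \<in> topspace (A_topology p W)"
      unfolding A_topology_def topology_generated_by_topspace using f by blast
  qed
qed

definition has_A_extension ::
    "enat \<Rightarrow> (complex ^ 'n) set \<Rightarrow> (complex ^ 'n) set \<Rightarrow> (complex ^ 'n \<Rightarrow> complex) \<Rightarrow> bool"
  where "has_A_extension p \<Omega> G f \<longleftrightarrow> (\<exists>F\<in>A_space p \<Omega>. \<forall>z\<in>G. F z = f z)"

end

theory Submission
  imports Defs "HOL-Complex_Analysis.Conformal_Mappings"
begin

text \<open>
The extendable functions form a linear subspace \<open>E\<close> of \<open>A\<^sup>p(G)\<close>, which is a proper subspace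
because \<open>f\<^sub>0\<close> is not in \<open>E\<close>. The theorem holds because \<open>E\<close> is also closed: its complement is then
open, hence a \<open>G\<^sub>\<delta>\<close> set, and the complement of a proper linear subspace is dense, since
for \<open>f\<close> in \<open>E\<close> the functions \<open>f + t f\<^sub>0\<close> with \<open>t > 0\<close> lie outside \<open>E\<close> and tend to \<open>f\<close> as \<open>t\<close> tends
to \<open>0\<close>.

Closedness of \<open>E\<close> rests on the maximum principle. Take a compact neighbourhood \<open>V\<close> of \<open>L\<close>
inside \<open>\<Omega>\<close>. The frontier of \<open>V\<close> lies in \<open>G\<close>, so if functions in \<open>E\<close> converge to \<open>f\<close> in \<open>A\<^sup>p(G)\<close>,
their extensions are uniformly Cauchy on the frontier of \<open>V\<close> and therefore on \<open>V\<close>. Their limit on \<open>V\<close>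
glues with \<open>f\<close> to a holomorphic function on \<open>\<Omega>\<close> (lemma \<open>holomorphic_extension_limit\<close>). A holomorphic
extension is automatically an extension in \<open>A\<^sup>p(\<Omega>)\<close> (lemma \<open>has_A_extension_iff\<close>): near the boundary
of \<open>\<Omega>\<close> one stays away from \<open>L\<close>, so there the derivatives extend continuously because those of
\<open>f\<close> do, and inside \<open>\<Omega>\<close> all derivatives of a holomorphic function are continuous.
A neighbourhood of a non-extendable function that misses \<open>E\<close> is thus a ball for the seminorm
with \<open>\<alpha> = 0\<close> and a radius \<open>N\<close> for which \<open>V\<close> lies in the ball of radius \<open>N\<close>.

The facts about several complex variables that this uses are reduced to one variable by
restricting functions to complex lines parallel to the coordinate axes. Cauchy's estimate
bounds the partial derivatives, so that uniform limits of holomorphic functions are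
holomorphic (lemma \<open>holomorphic_Cn_on_uniform_limit\<close>). Partial derivatives are locally uniform
limits of difference quotients, hence holomorphic themselves (lemma \<open>holomorphic_Cn_on_cpartial\<close>).
\<close>

(* Without this, z $ j also parses as a coefficient of a formal power series. *)
no_notation fps_nth (infixl "$" 75)

section \<open>Complex lines parallel to the coordinate axes\<close>

definition slice :: "'n \<Rightarrow> complex ^ 'n \<Rightarrow> complex \<Rightarrow> complex ^ 'n"
  where "slice j z w = (\<chi> i. if i = j then w else z $ i)"

lemma cpartial_slice: "cpartial j f z = deriv (\<lambda>w. f (slice j z w)) (z $ j)"
  by (simp add: cpartial_def slice_def)

lemma slice_self [simp]: "slice j z (z $ j) = z"
  by (simp add: slice_def vec_eq_iff)

lemma slice_nth [simp]: "slice j z w $ j = w"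
  by (simp add: slice_def)

lemma slice_eq_axis: "slice j z w = z + axis j (w - z $ j)"
  by (simp add: slice_def axis_def vec_eq_iff)

lemma norm_axis_complex: "norm (axis j (c :: complex)) = cmod c"
proof -
  have "(\<Sum>i\<in>UNIV. (cmod (axis j c $ i))\<^sup>2) = (\<Sum>i\<in>UNIV. if i = j then (cmod c)\<^sup>2 else 0)"
    by (rule sum.cong) (auto simp: axis_def)
  then show ?thesis
    by (simp add: norm_vec_def L2_set_def)
qed

lemma dist_slice: "dist (slice j z v) (slice j z w) = dist v (w :: complex)"
proof -
  have "slice j z v - slice j z w = axis j (v - w)"
    by (simp add: slice_def axis_def vec_eq_iff)
  then show ?thesis by (simp add: dist_norm norm_axis_complex)
qed

lemma dist_slice_self: "dist z (slice j z w) = dist (z $ j) w"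
  using dist_slice[of j z "z $ j" w] by simp

lemma has_derivative_slice:
  "(slice j z has_derivative axis j) (at w)"
proof -
  have bl: "bounded_linear (axis j :: complex \<Rightarrow> complex ^ 'a)"
    by (rule bounded_linear_intro[where K=1]) (auto simp: norm_axis_complex, auto simp: axis_def vec_eq_iff)
  have "((\<lambda>w. z + axis j (w - z $ j)) has_derivative (\<lambda>h. 0 + axis j (h - 0))) (at w)"
    by (intro has_derivative_add has_derivative_const bounded_linear.has_derivative[OF bl]
        has_derivative_diff has_derivative_ident)
  moreover have "slice j z = (\<lambda>w. z + axis j (w - z $ j))"
    by (simp add: fun_eq_iff slice_eq_axis)
  ultimately show ?thesis
    by simp
qed

lemma continuous_on_slice: "continuous_on S (slice j z)"
  by (intro continuous_at_imp_continuous_on ballI has_derivative_continuous[OF has_derivative_slice])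

lemma open_slice_vimage: "open W \<Longrightarrow> open (slice j z -` W)"
  by (rule open_vimage[OF _ continuous_on_slice])

lemma axis_eq_scale: "axis j h = h *s axis j (1::complex)"
  by (simp add: axis_def vec_eq_iff)

section \<open>Holomorphic functions of several variables\<close>

lemma holomorphic_slice_has_deriv:
  assumes f: "(f has_derivative D) (at (slice j z w))"
    and D: "\<And>c v. D (c *s v) = c * D v"
  shows "((\<lambda>w. f (slice j z w)) has_field_derivative D (axis j 1)) (at w)"
proof -
  have "((\<lambda>w. f (slice j z w)) has_derivative (\<lambda>h. D (axis j h))) (at w)"
    using has_derivative_compose[OF has_derivative_slice f] .
  moreover have "(\<lambda>h. D (axis j h)) = (*) (D (axis j 1))"
    by (subst axis_eq_scale) (auto simp: D)
  ultimately show ?thesis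
    by (simp add: has_field_derivative_def)
qed

lemma cpartial_eq_derivative:
  assumes "(f has_derivative D) (at z)" "\<And>c v. D (c *s v) = c * D v"
  shows "cpartial j f z = D (axis j 1)"
  unfolding cpartial_slice
  by (rule DERIV_imp_deriv) (rule holomorphic_slice_has_deriv, use assms in auto)

text \<open>
A complex-linear map is determined by its values on the standard basis, and these are the
partial derivatives. This explicit form of the derivative is what passes to uniform limits.
\<close>

lemma has_derivative_cpartial:
  assumes "holomorphic_Cn_on f W" "z \<in> W"
  shows "(f has_derivative (\<lambda>h. \<Sum>j\<in>UNIV. h $ j * cpartial j f z)) (at z)"
proof -
  obtain D where D: "(f has_derivative D) (at z)" "\<And>c v. D (c *s v) = c * D v"
    using assms by (auto simp: holomorphic_Cn_on_def)
  have "D h = (\<Sum>j\<in>UNIV. h $ j * cpartial j f z)" for h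
  proof -
    have "D h = D (\<Sum>j\<in>UNIV. h $ j *s axis j 1)"
      by (simp add: basis_expansion)
    also have "\<dots> = (\<Sum>j\<in>UNIV. D (h $ j *s axis j 1))"
      using D(1) by (intro linear_sum) (simp add: has_derivative_linear)
    finally show ?thesis
      by (simp add: D(2) cpartial_eq_derivative[OF D])
  qed
  then show ?thesis
    using D(1) by (simp flip: \<open>\<And>h. D h = _\<close>)
qed

lemma holomorphic_Cn_onI:
  assumes "\<And>z. z \<in> W \<Longrightarrow> \<exists>a. (f has_derivative (\<lambda>h. \<Sum>j\<in>UNIV. h $ j * a j)) (at z)"
  shows "holomorphic_Cn_on f W"
  unfolding holomorphic_Cn_on_def
proof
  fix z assume "z \<in> W"
  then obtain a where "(f has_derivative (\<lambda>h. \<Sum>j\<in>UNIV. h $ j * a j)) (at z)"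
    using assms by blast
  then show "\<exists>D. (f has_derivative D) (at z) \<and> (\<forall>c v. D (c *s v) = c * D v)"
    by (intro exI[of _ "\<lambda>h. \<Sum>j\<in>UNIV. h $ j * a j"]) (auto simp: sum_distrib_left mult.assoc)
qed

lemma holomorphic_Cn_on_subset:
  "holomorphic_Cn_on f W \<Longrightarrow> V \<subseteq> W \<Longrightarrow> holomorphic_Cn_on f V"
  by (auto simp: holomorphic_Cn_on_def)

lemma holomorphic_Cn_on_imp_continuous_on:
  assumes "holomorphic_Cn_on f W"
  shows "continuous_on W f"
  using assms unfolding holomorphic_Cn_on_def
  by (meson continuous_at_imp_continuous_on has_derivative_continuous)

lemma holomorphic_Cn_on_local:
  assumes "\<And>z. z \<in> W \<Longrightarrow> \<exists>U. z \<in> U \<and> holomorphic_Cn_on f U"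
  shows "holomorphic_Cn_on f W"
  using assms unfolding holomorphic_Cn_on_def by blast

lemma holomorphic_Cn_on_cong:
  assumes "open W" "\<And>z. z \<in> W \<Longrightarrow> f z = g z" "holomorphic_Cn_on f W"
  shows "holomorphic_Cn_on g W"
  unfolding holomorphic_Cn_on_def
proof
  fix z assume z: "z \<in> W"
  then obtain D where D: "(f has_derivative D) (at z)" "\<forall>c v. D (c *s v) = c * D v"
    using assms(3) unfolding holomorphic_Cn_on_def by blast
  have "(g has_derivative D) (at z)"
    by (rule has_derivative_transform_within_open[OF D(1) assms(1) z]) (simp add: assms(2))
  with D(2) show "\<exists>D. (g has_derivative D) (at z) \<and> (\<forall>c v. D (c *s v) = c * D v)"
    by blast
qed

lemma holomorphic_Cn_on_lincomb:
  assumes "holomorphic_Cn_on f W" "holomorphic_Cn_on g W"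
  shows "holomorphic_Cn_on (\<lambda>z. a * f z + b * g z) W"
  unfolding holomorphic_Cn_on_def
proof
  fix z assume "z \<in> W"
  then obtain D E where
    D: "(f has_derivative D) (at z)" "\<And>c v. D (c *s v) = c * D v" and
    E: "(g has_derivative E) (at z)" "\<And>c v. E (c *s v) = c * E v"
    using assms unfolding holomorphic_Cn_on_def by meson
  show "\<exists>D. ((\<lambda>z. a * f z + b * g z) has_derivative D) (at z) \<and> (\<forall>c v. D (c *s v) = c * D v)"
    by (rule exI[of _ "\<lambda>h. a * D h + b * E h"])
      (auto intro!: derivative_eq_intros D(1) E(1) simp: D(2) E(2) algebra_simps)
qed

lemma holomorphic_Cn_on_shift:
  assumes "holomorphic_Cn_on f W" "(\<lambda>z. z + a) ` V \<subseteq> W"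
  shows "holomorphic_Cn_on (\<lambda>z. f (z + a)) V"
  unfolding holomorphic_Cn_on_def
proof
  fix z assume "z \<in> V"
  then obtain D where D: "(f has_derivative D) (at (z + a))" "\<And>c v. D (c *s v) = c * D v"
    using assms unfolding holomorphic_Cn_on_def by blast
  have "((\<lambda>z. f (z + a)) has_derivative D) (at z)"
    by (rule has_derivative_compose[of "\<lambda>z. z + a" "\<lambda>h. h", OF _ D(1)])
      (auto intro!: derivative_eq_intros)
  with D(2) show "\<exists>D. ((\<lambda>z. f (z + a)) has_derivative D) (at z) \<and> (\<forall>c v. D (c *s v) = c * D v)"
    by blast
qed

lemma holomorphic_on_slice:
  assumes "holomorphic_Cn_on f W"
  shows "(\<lambda>w. f (slice j z w)) holomorphic_on (slice j z -` W)"
  unfolding holomorphic_on_def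
proof
  fix w assume "w \<in> slice j z -` W"
  then obtain D where D: "(f has_derivative D) (at (slice j z w))" "\<And>c v. D (c *s v) = c * D v"
    using assms unfolding holomorphic_Cn_on_def by blast
  show "(\<lambda>w. f (slice j z w)) field_differentiable at w within slice j z -` W"
    using holomorphic_slice_has_deriv[OF D]
    by (meson field_differentiable_def field_differentiable_at_within)
qed

lemma slice_cball: "w \<in> cball (z $ j) r \<Longrightarrow> slice j z w \<in> cball z r"
  by (simp add: dist_slice_self)

text \<open>
Cauchy's estimate for the restriction of \<open>f\<close> to the line through \<open>z\<close> in direction \<open>j\<close>.
\<close>

lemma cpartial_le:
  assumes f: "holomorphic_Cn_on f W" and W: "cball z r \<subseteq> W" and r: "0 < r"
    and B: "\<And>x. x \<in> cball z r \<Longrightarrow> cmod (f x) \<le> B"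
  shows "cmod (cpartial j f z) \<le> B / r"
proof -
  let ?\<phi> = "\<lambda>w. f (slice j z w)"
  have sub: "cball (z $ j) r \<subseteq> slice j z -` W"
    using slice_cball W by blast
  have hol: "?\<phi> holomorphic_on cball (z $ j) r"
    using holomorphic_on_slice[OF f] sub holomorphic_on_subset by blast
  have "norm ((deriv ^^ 1) ?\<phi> (z $ j)) \<le> fact 1 * B / r ^ 1"
  proof (rule Cauchy_inequality)
    show "?\<phi> holomorphic_on ball (z $ j) r"
      using hol ball_subset_cball holomorphic_on_subset by blast
    show "continuous_on (cball (z $ j) r) ?\<phi>"
      using hol by (rule holomorphic_on_imp_continuous_on)
    fix w assume "cmod (z $ j - w) = r"
    then show "cmod (?\<phi> w) \<le> B"
      by (intro B slice_cball) (simp add: dist_norm)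
  qed (use r in auto)
  then show ?thesis by (simp add: cpartial_slice)
qed

lemma cpartial_lincomb:
  assumes "holomorphic_Cn_on f W" "holomorphic_Cn_on g W" "z \<in> W"
  shows "cpartial j (\<lambda>z. a * f z + b * g z) z = a * cpartial j f z + b * cpartial j g z"
proof -
  obtain D E where
    D: "(f has_derivative D) (at z)" "\<And>c v. D (c *s v) = c * D v" and
    E: "(g has_derivative E) (at z)" "\<And>c v. E (c *s v) = c * E v"
    using assms unfolding holomorphic_Cn_on_def by meson
  have "cpartial j (\<lambda>z. a * f z + b * g z) z = a * D (axis j 1) + b * E (axis j 1)"
    by (rule cpartial_eq_derivative)
      (auto intro!: derivative_eq_intros D(1) E(1) simp: D(2) E(2) algebra_simps)
  then show ?thesis by (simp add: cpartial_eq_derivative[OF D] cpartial_eq_derivative[OF E])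
qed

section \<open>Uniform limits and partial derivatives\<close>

text \<open>
Cauchy's estimate applied to \<open>f m - f n\<close> on balls of the fixed radius \<open>r\<close> shows that the partial
derivatives are uniformly Cauchy as soon as the functions are.
\<close>

lemma uniform_limit_cpartial:
  fixes f :: "nat \<Rightarrow> complex ^ 'n \<Rightarrow> complex"
  assumes hol: "\<And>n. holomorphic_Cn_on (f n) W"
    and lim: "uniform_limit W f g sequentially"
    and r: "0 < r" and sub: "\<And>x. x \<in> S \<Longrightarrow> cball x r \<subseteq> W"
  shows "uniformly_convergent_on S (\<lambda>n. cpartial j (f n))"
  unfolding uniformly_convergent_eq_Cauchy
proof (rule uniformly_Cauchy_onI)
  fix e :: real assume e: "0 < e"
  have "uniformly_Cauchy_on W f"
    unfolding uniformly_convergent_eq_Cauchy[symmetric] uniformly_convergent_on_def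
    using lim by blast
  then obtain M where M: "\<And>x m n. x \<in> W \<Longrightarrow> M \<le> m \<Longrightarrow> M \<le> n \<Longrightarrow> dist (f m x) (f n x) < e * r / 2"
    using e r unfolding uniformly_Cauchy_on_def by (meson half_gt_zero mult_pos_pos)
  have "dist (cpartial j (f m) x) (cpartial j (f n) x) < e" if x: "x \<in> S" and mn: "M \<le> m" "M \<le> n" for x m n
  proof -
    have "x \<in> W" using sub[OF x] r by auto
    let ?d = "\<lambda>z. 1 * f m z + (- 1) * f n z"
    have "cmod (cpartial j ?d x) \<le> (e * r / 2) / r"
    proof (rule cpartial_le[OF holomorphic_Cn_on_lincomb[OF hol hol] sub[OF x] r])
      fix y assume "y \<in> cball x r"
      then have "dist (f m y) (f n y) < e * r / 2" using M sub[OF x] mn by blast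
      then show "cmod (?d y) \<le> e * r / 2" by (simp add: dist_norm)
    qed
    moreover have "cpartial j ?d x = cpartial j (f m) x - cpartial j (f n) x"
      by (subst cpartial_lincomb[OF hol hol \<open>x \<in> W\<close>]) simp
    ultimately show ?thesis using e r by (simp add: dist_norm)
  qed
  then show "\<exists>M. \<forall>x\<in>S. \<forall>m\<ge>M. \<forall>n\<ge>M. dist (cpartial j (f m) x) (cpartial j (f n) x) < e"
    by blast
qed

text \<open>
Weierstrass' theorem in several variables. On a ball whose points keep a distance \<open>r\<close> from
the complement of \<open>W\<close>, the partial derivatives converge uniformly, and therefore so do
the total derivatives; differentiating the limit term by term gives a derivative that is again
given by partial derivatives, hence complex linear.
\<close>

lemma holomorphic_Cn_on_uniform_limit:
  fixes f :: "nat \<Rightarrow> complex ^ 'n \<Rightarrow> complex"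
  assumes W: "open W" and hol: "\<And>n. holomorphic_Cn_on (f n) W"
    and lim: "uniform_limit W f g sequentially"
  shows "holomorphic_Cn_on g W"
proof (rule holomorphic_Cn_onI)
  fix z assume z: "z \<in> W"
  obtain r where r: "0 < r" "cball z (2 * r) \<subseteq> W"
  proof -
    obtain e where "0 < e" "cball z e \<subseteq> W" using W z open_contains_cball by blast
    then show ?thesis using that[of "e / 2"] by simp
  qed
  define S where "S = ball z r"
  have S: "convex S" "open S" "z \<in> S" using r by (auto simp: S_def)
  have sub: "cball x r \<subseteq> W" if "x \<in> S" for x
  proof
    fix y assume "y \<in> cball x r"
    then have "dist z y \<le> 2 * r"
      using that dist_triangle[of z y x] by (simp add: S_def)
    then show "y \<in> W" using r by auto
  qed
  then have SW: "S \<subseteq> W" using r centre_in_cball by (metis less_imp_le subset_eq)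
  have "\<exists>d. uniform_limit S (\<lambda>n. cpartial j (f n)) d sequentially" for j
    using uniform_limit_cpartial[OF hol lim r(1) sub]
    by (auto simp: uniformly_convergent_on_def)
  then have "\<forall>j. \<exists>d. uniform_limit S (\<lambda>n. cpartial j (f n)) d sequentially" ..
  from choice[OF this]
  obtain d where d: "\<And>j. uniform_limit S (\<lambda>n. cpartial j (f n)) (d j) sequentially"
    by blast
  have "\<exists>G. \<forall>x\<in>S. (\<lambda>n. f n x) \<longlonglongrightarrow> G x \<and>
      (G has_derivative (\<lambda>h. \<Sum>j\<in>UNIV. h $ j * d j x)) (at x within S)"
  proof (rule has_derivative_sequence)
    show "(f n has_derivative (\<lambda>h. \<Sum>j\<in>UNIV. h $ j * cpartial j (f n) x)) (at x within S)"
      if "x \<in> S" for n x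
      by (rule has_derivative_at_withinI[OF has_derivative_cpartial[OF hol]]) (use that SW in blast)
    show "(\<lambda>n. f n z) \<longlonglongrightarrow> g z"
      using lim z by (rule tendsto_uniform_limitI)
    fix e :: real assume e: "0 < e"
    define c where "c = real CARD('n)"
    have c: "0 < c" by (simp add: c_def)
    have "\<forall>\<^sub>F n in sequentially. \<forall>j. \<forall>x\<in>S. dist (cpartial j (f n) x) (d j x) < e / c"
      using d e c by (simp add: eventually_all_finite uniform_limit_iff)
    then show "\<forall>\<^sub>F n in sequentially. \<forall>x\<in>S. \<forall>h.
        norm ((\<Sum>j\<in>UNIV. h $ j * cpartial j (f n) x) - (\<Sum>j\<in>UNIV. h $ j * d j x)) \<le> e * norm h"
    proof eventually_elim
      case (elim n)
      show ?case
      proof (intro ballI allI)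
        fix x h assume x: "x \<in> S"
        have "norm ((\<Sum>j\<in>UNIV. h $ j * cpartial j (f n) x) - (\<Sum>j\<in>UNIV. h $ j * d j x))
            = norm (\<Sum>j\<in>UNIV. h $ j * (cpartial j (f n) x - d j x))"
          by (simp add: sum_subtractf algebra_simps)
        also have "\<dots> \<le> (\<Sum>j\<in>(UNIV :: 'n set). norm h * (e / c))"
        proof (rule sum_norm_le)
          fix j
          have "cmod (cpartial j (f n) x - d j x) \<le> e / c"
            using elim x by (simp add: dist_norm less_imp_le)
          then show "cmod (h $ j * (cpartial j (f n) x - d j x)) \<le> norm h * (e / c)"
            unfolding norm_mult by (intro mult_mono Finite_Cartesian_Product.norm_nth_le) auto
        qed
        also have "\<dots> = e * norm h"
          using c by (simp add: c_def)
        finally show "norm ((\<Sum>j\<in>UNIV. h $ j * cpartial j (f n) x) - (\<Sum>j\<in>UNIV. h $ j * d j x)) \<le> e * norm h" .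
      qed
    qed
  qed (use S in auto)
  then obtain G where G: "\<And>x. x \<in> S \<Longrightarrow> (\<lambda>n. f n x) \<longlonglongrightarrow> G x"
    "(G has_derivative (\<lambda>h. \<Sum>j\<in>UNIV. h $ j * d j z)) (at z within S)"
    using S by blast
  have eq: "G x = g x" if "x \<in> S" for x
    by (rule LIMSEQ_unique[OF G(1)[OF that] tendsto_uniform_limitI[OF lim]]) (use that SW in blast)
  have "(G has_derivative (\<lambda>h. \<Sum>j\<in>UNIV. h $ j * d j z)) (at z)"
    using G(2) unfolding at_within_open[OF S(3,2)] .
  then have "(g has_derivative (\<lambda>h. \<Sum>j\<in>UNIV. h $ j * d j z)) (at z)"
    using S(2,3) eq by (rule has_derivative_transform_within_open)
  then show "\<exists>a. (g has_derivative (\<lambda>h. \<Sum>j\<in>UNIV. h $ j * a j)) (at z)"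
    by (rule exI[of _ "\<lambda>j. d j z"])
qed

text \<open>
Taylor's formula of order one, with the second derivative bounded by Cauchy's estimate. The
bound is uniform in the function \<open>\<phi>\<close> once \<open>B\<close> and \<open>r\<close> are fixed, which is what makes the difference
quotients of a function of several variables converge uniformly in the remaining variables.
\<close>

lemma difference_quotient_bound:
  assumes \<phi>: "\<phi> holomorphic_on cball a (2 * r)" and r: "0 < r"
    and B: "\<And>w. w \<in> cball a (2 * r) \<Longrightarrow> cmod (\<phi> w) \<le> B"
    and h: "h \<noteq> 0" "cmod h < r"
  shows "cmod ((\<phi> (a + h) - \<phi> a) / h - deriv \<phi> a) \<le> 2 * B / r\<^sup>2 * cmod h"
proof -
  have cb: "cball x r \<subseteq> cball a (2 * r)" if "x \<in> ball a r" for x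
  proof
    fix y assume "y \<in> cball x r"
    then show "y \<in> cball a (2 * r)"
      using that dist_triangle[of a y x] by simp
  qed
  have sub: "ball a r \<subseteq> ball a (2 * r)" using r by auto
  have hol: "\<phi> holomorphic_on ball a (2 * r)"
    using \<phi> ball_subset_cball holomorphic_on_subset by blast
  have "cmod ((deriv ^^ 0) \<phi> (a + h) - (\<Sum>i\<le>1. (deriv ^^ i) \<phi> a * (a + h - a) ^ i / fact i))
      \<le> (2 * B / r\<^sup>2) * cmod (a + h - a) ^ Suc 1 / fact 1"
  proof (rule complex_Taylor[where S = "ball a r"])
    fix i x assume "x \<in> ball a r"
    then have x: "x \<in> ball a (2 * r)" using sub by blast
    have "(deriv ^^ i) \<phi> holomorphic_on ball a (2 * r)"
      by (rule holomorphic_higher_deriv[OF hol]) simp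
    from holomorphic_derivI[OF this _ x]
    show "((deriv ^^ i) \<phi> has_field_derivative (deriv ^^ Suc i) \<phi> x) (at x within ball a r)"
      by simp
  next
    fix x assume x: "x \<in> ball a r"
    have "cmod ((deriv ^^ 2) \<phi> x) \<le> fact 2 * B / r ^ 2"
    proof (rule Cauchy_inequality[OF _ _ r])
      show "\<phi> holomorphic_on ball x r"
        by (rule holomorphic_on_subset[OF \<phi>]) (use cb[OF x] ball_subset_cball in blast)
      show "continuous_on (cball x r) \<phi>"
        by (rule holomorphic_on_imp_continuous_on, rule holomorphic_on_subset[OF \<phi> cb[OF x]])
      fix y assume "cmod (x - y) = r"
      then have "y \<in> cball x r" by (simp add: dist_norm)
      then show "cmod (\<phi> y) \<le> B" using B cb[OF x] by blast
    qed
    then show "cmod ((deriv ^^ Suc 1) \<phi> x) \<le> 2 * B / r\<^sup>2"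
      by (simp add: numeral_2_eq_2)
  qed (use r h in \<open>auto simp: dist_norm\<close>)
  then have le: "cmod (\<phi> (a + h) - \<phi> a - deriv \<phi> a * h) \<le> 2 * B / r\<^sup>2 * (cmod h)\<^sup>2"
    by (simp add: power2_eq_square algebra_simps)
  have "(\<phi> (a + h) - \<phi> a) / h - deriv \<phi> a = (\<phi> (a + h) - \<phi> a - deriv \<phi> a * h) / h"
    using h by (simp add: field_simps)
  then have "cmod ((\<phi> (a + h) - \<phi> a) / h - deriv \<phi> a) = cmod (\<phi> (a + h) - \<phi> a - deriv \<phi> a * h) / cmod h"
    by (simp add: norm_divide)
  also have "\<dots> \<le> (2 * B / r\<^sup>2 * (cmod h)\<^sup>2) / cmod h"
    using le by (rule divide_right_mono) simp
  also have "\<dots> = 2 * B / r\<^sup>2 * cmod h"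
    using h by (simp add: power2_eq_square)
  finally show ?thesis .
qed

text \<open>
Near each point the partial derivative is a uniform limit of difference quotients
in the direction \<open>j\<close>, and these are holomorphic as linear combinations of translates of \<open>f\<close>.
\<close>

lemma holomorphic_Cn_on_cpartial:
  fixes f :: "complex ^ 'n \<Rightarrow> complex"
  assumes W: "open W" and hol: "holomorphic_Cn_on f W"
  shows "holomorphic_Cn_on (cpartial j f) W"
proof (rule holomorphic_Cn_on_local)
  fix z assume z: "z \<in> W"
  obtain r where r: "0 < r" "cball z (3 * r) \<subseteq> W"
  proof -
    obtain e where "0 < e" "cball z e \<subseteq> W" using W z open_contains_cball by blast
    then show ?thesis using that[of "e / 3"] by simp
  qed
  have "continuous_on (cball z (3 * r)) f"
    using continuous_on_subset[OF holomorphic_Cn_on_imp_continuous_on[OF hol] r(2)] .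
  then have "compact (f ` cball z (3 * r))"
    by (rule compact_continuous_image) simp
  then obtain B where B: "\<And>x. x \<in> cball z (3 * r) \<Longrightarrow> cmod (f x) \<le> B"
    using compact_imp_bounded bounded_iff by (metis imageI)
  (* The step sizes tend to 0 and stay below r, so that translates are defined on ball z r. *)
  define h where "h n = complex_of_real (r / real (n + 2))" for n
  have h: "h n \<noteq> 0" "cmod (h n) < r" for n
  proof -
    have "0 < r / real (n + 2)" "r / real (n + 2) < r"
      using r by (auto simp: divide_less_eq add_pos_nonneg ring_distribs)
    then show "h n \<noteq> 0" "cmod (h n) < r"
      unfolding h_def norm_of_real of_real_eq_0_iff by linarith+
  qed
  have h0: "h \<longlonglongrightarrow> 0"
    using tendsto_of_real[OF LIMSEQ_ignore_initial_segment[OF lim_const_over_n[of r], of 2]]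
    unfolding h_def of_real_0 .
  define q where "q n x = 1 / h n * f (x + axis j (h n)) + (- 1 / h n) * f x" for n x
  have cb: "cball x (2 * r) \<subseteq> cball z (3 * r)" if "x \<in> ball z r" for x
  proof
    fix y assume "y \<in> cball x (2 * r)"
    then show "y \<in> cball z (3 * r)"
      using that dist_triangle[of z y x] by simp
  qed
  have q: "holomorphic_Cn_on (q n) (ball z r)" for n
    unfolding q_def
  proof (rule holomorphic_Cn_on_lincomb)
    show "holomorphic_Cn_on f (ball z r)"
      by (rule holomorphic_Cn_on_subset[OF hol]) (use r in auto)
    show "holomorphic_Cn_on (\<lambda>x. f (x + axis j (h n))) (ball z r)"
    proof (rule holomorphic_Cn_on_shift[OF hol], rule image_subsetI)
      fix x assume x: "x \<in> ball z r"
      have "dist x (x + axis j (h n)) < r" using h(2)[of n] by (simp add: dist_norm norm_axis_complex)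
      then have "x + axis j (h n) \<in> cball x (2 * r)" using r by simp
      then show "x + axis j (h n) \<in> W" using cb[OF x] r by blast
    qed
  qed
  have est: "cmod (q n x - cpartial j f x) \<le> 2 * B / r\<^sup>2 * cmod (h n)" if x: "x \<in> ball z r" for n x
  proof -
    have sl: "slice j x w \<in> cball z (3 * r)" if "w \<in> cball (x $ j) (2 * r)" for w
      using slice_cball[OF that] cb[OF x] by blast
    have "cmod ((f (slice j x (x $ j + h n)) - f (slice j x (x $ j))) / h n - deriv (\<lambda>w. f (slice j x w)) (x $ j))
      \<le> 2 * B / r\<^sup>2 * cmod (h n)"
    proof (rule difference_quotient_bound[OF _ r(1) _ h])
      show "(\<lambda>w. f (slice j x w)) holomorphic_on cball (x $ j) (2 * r)"
        by (rule holomorphic_on_subset[OF holomorphic_on_slice[OF hol]]) (use sl r(2) in blast)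
    qed (use sl B in blast)
    moreover have "slice j x (x $ j + h n) = x + axis j (h n)"
      by (simp add: slice_eq_axis)
    ultimately show ?thesis
      by (simp add: q_def cpartial_slice diff_divide_distrib)
  qed
  have "uniform_limit (ball z r) q (cpartial j f) sequentially"
  proof (rule uniform_limitI)
    fix e :: real assume e: "0 < e"
    have "(\<lambda>n. 2 * B / r\<^sup>2 * cmod (h n)) \<longlonglongrightarrow> 2 * B / r\<^sup>2 * cmod 0"
      by (intro tendsto_intros h0)
    then have "\<forall>\<^sub>F n in sequentially. 2 * B / r\<^sup>2 * cmod (h n) < e"
      using e by (intro order_tendstoD) auto
    then show "\<forall>\<^sub>F n in sequentially. \<forall>x\<in>ball z r. dist (q n x) (cpartial j f x) < e"
    proof eventually_elim
      case (elim n)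
      then show ?case
        using est[of _ n] by (auto simp only: dist_norm intro: order.strict_trans1)
    qed
  qed
  then have "holomorphic_Cn_on (cpartial j f) (ball z r)"
    by (rule holomorphic_Cn_on_uniform_limit[OF open_ball q])
  then show "\<exists>U. z \<in> U \<and> holomorphic_Cn_on (cpartial j f) U"
    using r by (intro exI[of _ "ball z r"]) auto
qed

section \<open>Mixed partial derivatives and their linearity\<close>

text \<open>
A mixed derivative is an iteration of first partial derivatives. The relation
has three arguments so that it can express that one function is a linear combination of two others.
\<close>

lemma mixed_partial_rel:
  assumes "\<And>j f g h. R f g h \<Longrightarrow> R (cpartial j f) (cpartial j g) (cpartial j h)" and "R f g h"
  shows "R (mixed_partial \<alpha> f) (mixed_partial \<alpha> g) (mixed_partial \<alpha> h)"
proof -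
  have pow: "R ((cpartial j ^^ k) f) ((cpartial j ^^ k) g) ((cpartial j ^^ k) h)" if "R f g h" for j k f g h
    using that by (induction k) (auto intro: assms(1))
  have "R (fold (\<lambda>j. cpartial j ^^ (\<alpha> $ j)) js f) (fold (\<lambda>j. cpartial j ^^ (\<alpha> $ j)) js g)
      (fold (\<lambda>j. cpartial j ^^ (\<alpha> $ j)) js h)" for js
    using assms(2) by (induction js arbitrary: f g h) (auto intro: pow)
  then show ?thesis by (simp add: mixed_partial_def)
qed

lemma mixed_partial_0 [simp]: "mixed_partial 0 f = f"
proof -
  have "fold (\<lambda>j. cpartial j ^^ ((0 :: nat ^ 'a) $ j)) js f = f" for js
    by (induction js) auto
  then show ?thesis by (simp add: mixed_partial_def)
qed

lemma cpartial_cong: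
  assumes "open W" "z \<in> W" "\<And>z. z \<in> W \<Longrightarrow> f z = g z"
  shows "cpartial j f z = cpartial j g z"
  unfolding cpartial_slice
proof (rule deriv_cong_ev)
  have "\<forall>\<^sub>F w in nhds (z $ j). w \<in> slice j z -` W"
    using assms(2) open_slice_vimage[OF assms(1)] by (intro eventually_nhds_in_open) auto
  then show "\<forall>\<^sub>F w in nhds (z $ j). f (slice j z w) = g (slice j z w)"
    by eventually_elim (simp add: assms(3))
qed simp

lemma holomorphic_Cn_on_mixed_partial:
  assumes "open W" "holomorphic_Cn_on f W"
  shows "holomorphic_Cn_on (mixed_partial \<alpha> f) W"
  using mixed_partial_rel[of "\<lambda>f _ _. holomorphic_Cn_on f W" f f f] assms
  by (blast intro: holomorphic_Cn_on_cpartial)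

lemma mixed_partial_lincomb:
  assumes W: "open W" and f: "holomorphic_Cn_on f W" and g: "holomorphic_Cn_on g W"
    and h: "\<And>z. z \<in> W \<Longrightarrow> h z = a * f z + b * g z" and z: "z \<in> W"
  shows "mixed_partial \<alpha> h z = a * mixed_partial \<alpha> f z + b * mixed_partial \<alpha> g z"
proof -
  define R where "R f g h \<longleftrightarrow> holomorphic_Cn_on f W \<and> holomorphic_Cn_on g W \<and>
      (\<forall>z\<in>W. h z = a * f z + b * g z)" for f g h :: "complex ^ 'a \<Rightarrow> complex"
  have "R (cpartial j f) (cpartial j g) (cpartial j h)" if "R f g h" for j f g h
  proof -
    have "cpartial j h z = cpartial j (\<lambda>z. a * f z + b * g z) z" if "z \<in> W" for z
      using \<open>R f g h\<close> by (intro cpartial_cong[OF W that]) (simp add: R_def)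
    then show ?thesis
      using that W cpartial_lincomb[of f W g] by (simp add: R_def holomorphic_Cn_on_cpartial)
  qed
  moreover have "R f g h" using assms by (simp add: R_def)
  ultimately have "R (mixed_partial \<alpha> f) (mixed_partial \<alpha> g) (mixed_partial \<alpha> h)"
    by (rule mixed_partial_rel)
  with z show ?thesis by (simp add: R_def)
qed

lemma mixed_partial_cong:
  assumes "open W" "holomorphic_Cn_on f W" "\<And>z. z \<in> W \<Longrightarrow> g z = f z" "z \<in> W"
  shows "mixed_partial \<alpha> g z = mixed_partial \<alpha> f z"
  using mixed_partial_lincomb[of W f f g 1 0 z \<alpha>] assms by simp

section \<open>The seminorms\<close>

text \<open>
Membership in \<open>A_space\<close> apart from the requirement that the function is \<open>undefined\<close> outside \<open>W\<close>.
Sums and differences, taken pointwise, do not satisfy that requirement, but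
the seminorms must be estimated on them.
\<close>

definition A_regular :: "enat \<Rightarrow> (complex ^ 'n) set \<Rightarrow> (complex ^ 'n \<Rightarrow> complex) \<Rightarrow> bool"
  where "A_regular p W f \<longleftrightarrow> holomorphic_Cn_on f W \<and>
    (\<forall>\<alpha>. enat (multi_order \<alpha>) \<le> p \<longrightarrow> (\<exists>g. cont_extension W (mixed_partial \<alpha> f) g))"

lemma A_space_eq: "A_space p W = {f \<in> extensional W. A_regular p W f}"
  by (simp add: A_space_def A_regular_def)

lemma cont_extension_lincomb:
  assumes W: "open W" and f: "holomorphic_Cn_on f W" and g: "holomorphic_Cn_on g W"
    and h: "\<And>z. z \<in> W \<Longrightarrow> h z = a * f z + b * g z"
    and F: "cont_extension W (mixed_partial \<alpha> f) F" and G: "cont_extension W (mixed_partial \<alpha> g) G"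
  shows "cont_extension W (mixed_partial \<alpha> h) (\<lambda>z. a * F z + b * G z)"
  unfolding cont_extension_def
proof
  show "continuous_on (closure W) (\<lambda>z. a * F z + b * G z)"
    using F G unfolding cont_extension_def by (intro continuous_intros) auto
  show "\<forall>z\<in>W. a * F z + b * G z = mixed_partial \<alpha> h z"
    using F G mixed_partial_lincomb[OF W f g h] by (simp add: cont_extension_def)
qed

lemma A_regular_lincomb:
  assumes W: "open W" and f: "A_regular p W f" and g: "A_regular p W g"
    and h: "\<And>z. z \<in> W \<Longrightarrow> h z = a * f z + b * g z"
  shows "A_regular p W h"
proof -
  have fg: "holomorphic_Cn_on f W" "holomorphic_Cn_on g W"
    using f g by (auto simp: A_regular_def)
  have "holomorphic_Cn_on h W"
    by (rule holomorphic_Cn_on_cong[OF W _ holomorphic_Cn_on_lincomb[OF fg]]) (simp add: h)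
  moreover have "\<exists>H. cont_extension W (mixed_partial \<alpha> h) H" if \<alpha>: "enat (multi_order \<alpha>) \<le> p" for \<alpha>
  proof -
    obtain F G where "cont_extension W (mixed_partial \<alpha> f) F" "cont_extension W (mixed_partial \<alpha> g) G"
      using f g \<alpha> unfolding A_regular_def by blast
    from cont_extension_lincomb[OF W fg h this] show ?thesis by blast
  qed
  ultimately show ?thesis by (simp add: A_regular_def)
qed

lemma A_regular_cong:
  assumes "open W" "A_regular p W f" "\<And>z. z \<in> W \<Longrightarrow> h z = f z"
  shows "A_regular p W h"
  using A_regular_lincomb[of W p f f h 1 0] assms by simp

lemma cont_extension_unique:
  assumes "cont_extension W f g" "cont_extension W f h" "z \<in> closure W"
  shows "g z = h z"
proof -
  have "continuous_on (closure W) (\<lambda>z. g z - h z)"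
    using assms unfolding cont_extension_def by (intro continuous_intros) auto
  then have "g z - h z = 0"
    by (rule continuous_constant_on_closure) (use assms in \<open>auto simp: cont_extension_def\<close>)
  then show ?thesis by simp
qed

text \<open>
Any continuous extension may replace the chosen one in the seminorm, because a continuous
extension is unique on the closure.
\<close>

lemma A_seminorm_eq:
  assumes g: "cont_extension W (mixed_partial \<alpha> f) g"
  shows "A_seminorm W \<alpha> N f = Sup (insert 0 ((\<lambda>z. cmod (g z)) ` {z \<in> closure W. norm z \<le> real N}))"
proof -
  have "cont_extension W (mixed_partial \<alpha> f) (SOME g. cont_extension W (mixed_partial \<alpha> f) g)"
    by (rule someI[where P = "cont_extension W (mixed_partial \<alpha> f)", OF g])
  then have "(SOME g. cont_extension W (mixed_partial \<alpha> f) g) z = g z" if "z \<in> closure W" for z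
    using cont_extension_unique g that by blast
  then show ?thesis
    unfolding A_seminorm_def by (intro arg_cong[where f = Sup] arg_cong2[where f = insert] image_cong) auto
qed

lemma norm_extension_le_A_seminorm:
  assumes g: "cont_extension W (mixed_partial \<alpha> f) g" and z: "z \<in> closure W" "norm z \<le> real N"
  shows "cmod (g z) \<le> A_seminorm W \<alpha> N f"
  unfolding A_seminorm_eq[OF g]
proof (rule cSup_upper)
  have "{z \<in> closure W. norm z \<le> real N} = closure W \<inter> cball 0 (real N)"
    by auto
  then have "compact {z \<in> closure W. norm z \<le> real N}"
    by (simp add: closed_Int_compact)
  moreover have "continuous_on {z \<in> closure W. norm z \<le> real N} (\<lambda>z. cmod (g z))"
    using g unfolding cont_extension_def
    by (intro continuous_on_norm) (rule continuous_on_subset, auto)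
  ultimately have "compact ((\<lambda>z. cmod (g z)) ` {z \<in> closure W. norm z \<le> real N})"
    by (intro compact_continuous_image)
  then show "bdd_above (insert 0 ((\<lambda>z. cmod (g z)) ` {z \<in> closure W. norm z \<le> real N}))"
    by (simp add: compact_imp_bounded bounded_imp_bdd_above)
qed (use z in auto)

lemma A_seminorm_le:
  assumes g: "cont_extension W (mixed_partial \<alpha> f) g" and "0 \<le> B"
    and "\<And>z. z \<in> closure W \<Longrightarrow> norm z \<le> real N \<Longrightarrow> cmod (g z) \<le> B"
  shows "A_seminorm W \<alpha> N f \<le> B"
  unfolding A_seminorm_eq[OF g] using assms by (intro cSup_least) auto

lemma A_seminorm_nonneg:
  assumes g: "cont_extension W (mixed_partial \<alpha> f) g"
  shows "0 \<le> A_seminorm W \<alpha> N f"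
proof (cases "{z \<in> closure W. norm z \<le> real N} = {}")
  case True
  then show ?thesis unfolding A_seminorm_eq[OF g] by (simp only: image_empty) simp
next
  case False
  then obtain z where "z \<in> closure W" "norm z \<le> real N" by blast
  from norm_extension_le_A_seminorm[OF g this] show ?thesis
    using norm_ge_zero order_trans by blast
qed

lemma A_seminorm_lincomb_le:
  assumes W: "open W" and f: "A_regular p W f" and g: "A_regular p W g"
    and h: "\<And>z. z \<in> W \<Longrightarrow> h z = a * f z + b * g z" and \<alpha>: "enat (multi_order \<alpha>) \<le> p"
  shows "A_seminorm W \<alpha> N h \<le> cmod a * A_seminorm W \<alpha> N f + cmod b * A_seminorm W \<alpha> N g"
proof -
  obtain F G where F: "cont_extension W (mixed_partial \<alpha> f) F" and G: "cont_extension W (mixed_partial \<alpha> g) G"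
    using f g \<alpha> unfolding A_regular_def by blast
  have "holomorphic_Cn_on f W" "holomorphic_Cn_on g W"
    using f g by (auto simp: A_regular_def)
  then have "cont_extension W (mixed_partial \<alpha> h) (\<lambda>z. a * F z + b * G z)"
    using W h F G by (intro cont_extension_lincomb)
  then show ?thesis
  proof (rule A_seminorm_le)
    fix z assume z: "z \<in> closure W" "norm z \<le> real N"
    have "cmod (a * F z + b * G z) \<le> cmod a * cmod (F z) + cmod b * cmod (G z)"
      by (metis norm_mult norm_triangle_ineq)
    also have "\<dots> \<le> cmod a * A_seminorm W \<alpha> N f + cmod b * A_seminorm W \<alpha> N g"
      by (intro add_mono mult_left_mono norm_extension_le_A_seminorm[OF F z]
          norm_extension_le_A_seminorm[OF G z] norm_ge_zero)
    finally show "cmod (a * F z + b * G z) \<le> cmod a * A_seminorm W \<alpha> N f + cmod b * A_seminorm W \<alpha> N g" .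
  qed (use A_seminorm_nonneg[OF F] A_seminorm_nonneg[OF G] in simp)
qed

section \<open>The maximum principle and holomorphic extension across a compact set\<close>

text \<open>
One complex line through \<open>z\<close> suffices: its intersection with \<open>V\<close> is compact, and a frontier
point of the intersection, taken within the line, is a frontier point of \<open>V\<close>. The maximum
principle in one variable does the rest.
\<close>

lemma maximum_modulus_Cn:
  fixes f :: "complex ^ 'n \<Rightarrow> complex"
  assumes f: "holomorphic_Cn_on f W" and V: "compact V" "V \<subseteq> W"
    and B: "\<And>x. x \<in> frontier V \<Longrightarrow> cmod (f x) \<le> B" and z: "z \<in> V"
  shows "cmod (f z) \<le> B"
proof -
  fix j :: 'n
  define S where "S = slice j z -` V"
  have hol: "(\<lambda>w. f (slice j z w)) holomorphic_on S"
    by (rule holomorphic_on_subset[OF holomorphic_on_slice[OF f]]) (use V in \<open>auto simp: S_def\<close>)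
  have closed: "closed S"
    unfolding S_def using V(1) compact_imp_closed by (intro closed_vimage continuous_on_slice)
  have "cmod (f (slice j z (z $ j))) \<le> B"
  proof (rule maximum_modulus_frontier[where S = S and f = "\<lambda>w. f (slice j z w)"])
    show "(\<lambda>w. f (slice j z w)) holomorphic_on interior S"
      using hol interior_subset by (rule holomorphic_on_subset)
    show "continuous_on (closure S) (\<lambda>w. f (slice j z w))"
      using hol closed by (simp add: holomorphic_on_imp_continuous_on closure_closed)
    obtain C where C: "\<And>x. x \<in> V \<Longrightarrow> norm x \<le> C"
      using compact_imp_bounded[OF V(1)] unfolding bounded_iff by blast
    have "cmod w \<le> C" if "w \<in> S" for w
      using that C[of "slice j z w"] Finite_Cartesian_Product.norm_nth_le[of "slice j z w" j]
      by (simp add: S_def)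
    then show "bounded S" by (auto simp: bounded_iff)
    show "z $ j \<in> S" using z by (simp add: S_def)
    fix w assume w: "w \<in> frontier S"
    have "slice j z w \<in> V" using w closed by (auto simp: frontier_def S_def)
    moreover have "slice j z w \<notin> interior V"
    proof
      assume "slice j z w \<in> interior V"
      moreover have "slice j z -` interior V \<subseteq> interior S"
        using interior_subset[of V] by (intro interior_maximal open_slice_vimage) (auto simp: S_def)
      ultimately show False using w by (auto simp: frontier_def)
    qed
    ultimately show "cmod (f (slice j z w)) \<le> B"
      using closure_subset by (intro B) (auto simp: frontier_def)
  qed
  then show ?thesis by simp
qed

lemma compact_neighbourhood_in_open:
  fixes L :: "'a::heine_borel set"
  assumes "compact L" "open \<Omega>" "L \<subseteq> \<Omega>"
  obtains V where "compact V" "L \<subseteq> interior V" "V \<subseteq> \<Omega>"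
proof -
  obtain e where e: "0 < e" "(\<Union>x\<in>L. cball x e) \<subseteq> \<Omega>"
    using compact_subset_open_imp_cball_epsilon_subset[OF assms] .
  have "(\<Union>x\<in>L. ball x e) \<subseteq> interior (\<Union>x\<in>L. cball x e)"
    by (rule interior_maximal) (auto simp: less_imp_le)
  moreover have "L \<subseteq> (\<Union>x\<in>L. ball x e)" using e by auto
  ultimately show ?thesis
    using that[OF compact_minkowski_sum_cball[OF assms(1)] _ e(2)] by blast
qed

text \<open>
The continuous extension of a derivative of \<open>F\<close> is the derivative itself on \<open>\<Omega>\<close> and the extension \<open>g\<close>
known for \<open>f\<close> elsewhere. The two descriptions agree off \<open>L\<close>, and a point of the closure of \<open>\<Omega>\<close>
outside \<open>\<Omega>\<close> has a neighbourhood disjoint from \<open>L\<close>, in which only \<open>g\<close> matters.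
\<close>

lemma A_regular_glue:
  fixes \<Omega> L :: "(complex ^ 'n) set"
  assumes \<Omega>: "open \<Omega>" and L: "closed L" "L \<subseteq> \<Omega>" and f: "A_regular p (\<Omega> - L) f"
    and F: "holomorphic_Cn_on F \<Omega>" and eq: "\<And>z. z \<in> \<Omega> - L \<Longrightarrow> F z = f z"
  shows "A_regular p \<Omega> F"
  unfolding A_regular_def
proof (intro conjI F allI impI)
  fix \<alpha> :: "nat ^ 'n" assume "enat (multi_order \<alpha>) \<le> p"
  then obtain g where g: "cont_extension (\<Omega> - L) (mixed_partial \<alpha> f) g"
    using f by (auto simp: A_regular_def)
  have G: "open (\<Omega> - L)" using \<Omega> L by (simp add: open_Diff)
  have f_hol: "holomorphic_Cn_on f (\<Omega> - L)"
    using f by (simp add: A_regular_def)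
  define h where "h z = (if z \<in> \<Omega> then mixed_partial \<alpha> F z else g z)" for z
  have hg: "h z = g z" if "z \<notin> L" for z
  proof (cases "z \<in> \<Omega>")
    case True
    then have z: "z \<in> \<Omega> - L" using that by blast
    have "mixed_partial \<alpha> F z = mixed_partial \<alpha> f z"
      using G f_hol eq z by (rule mixed_partial_cong)
    then show ?thesis using g z by (simp add: h_def cont_extension_def)
  qed (simp add: h_def)
  have "continuous_on (closure \<Omega>) h"
    unfolding continuous_on_eq_continuous_within
  proof
    fix z assume z: "z \<in> closure \<Omega>"
    show "continuous (at z within closure \<Omega>) h"
    proof (cases "z \<in> \<Omega>")
      case True
      have "continuous_on \<Omega> (mixed_partial \<alpha> F)"
        by (rule holomorphic_Cn_on_imp_continuous_on[OF holomorphic_Cn_on_mixed_partial[OF \<Omega> F]])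
      then have "continuous_on \<Omega> h"
        by (rule continuous_on_eq) (simp add: h_def)
      then have "isCont h z" using True \<Omega> continuous_on_eq_continuous_at by blast
      then show ?thesis by (rule continuous_at_imp_continuous_at_within)
    next
      case False
      have sub: "closure \<Omega> \<inter> - L \<subseteq> closure (\<Omega> - L)"
        using open_Int_closure_subset[of "- L" \<Omega>] L by (simp add: Diff_eq Int_commute open_Compl)
      have "continuous_on (closure (\<Omega> - L)) g" using g by (simp add: cont_extension_def)
      then have "continuous_on (closure \<Omega> \<inter> - L) g" using sub by (rule continuous_on_subset)
      then have "continuous_on (closure \<Omega> \<inter> - L) h"
        by (rule continuous_on_eq) (simp add: hg)
      moreover have zL: "z \<in> - L" using False L by blast
      ultimately have "continuous (at z within (closure \<Omega> \<inter> - L)) h"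
        using z by (simp add: continuous_on_eq_continuous_within)
      moreover have "at z within (closure \<Omega> \<inter> - L) = at z within closure \<Omega>"
        using L(1) by (intro at_within_nhd[OF zL]) (auto simp: open_Compl)
      ultimately show ?thesis by simp
    qed
  qed
  then show "\<exists>g. cont_extension \<Omega> (mixed_partial \<alpha> F) g"
    by (intro exI[of _ h]) (simp add: cont_extension_def h_def)
qed

text \<open>
The continuity of the derivatives at the boundary of \<open>\<Omega>\<close> is inherited from \<open>f\<close>. This turns
extendability into a condition that can be checked on limits of functions alone.
\<close>

lemma has_A_extension_iff:
  fixes \<Omega> L :: "(complex ^ 'n) set"
  assumes \<Omega>: "open \<Omega>" and L: "closed L" "L \<subseteq> \<Omega>" and f: "A_regular p (\<Omega> - L) f"
  shows "has_A_extension p \<Omega> (\<Omega> - L) f \<longleftrightarrow>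
    (\<exists>F. holomorphic_Cn_on F \<Omega> \<and> (\<forall>z\<in>\<Omega> - L. F z = f z))"
proof
  assume "has_A_extension p \<Omega> (\<Omega> - L) f"
  then show "\<exists>F. holomorphic_Cn_on F \<Omega> \<and> (\<forall>z\<in>\<Omega> - L. F z = f z)"
    by (auto simp: has_A_extension_def A_space_def)
next
  assume "\<exists>F. holomorphic_Cn_on F \<Omega> \<and> (\<forall>z\<in>\<Omega> - L. F z = f z)"
  then obtain F where F: "holomorphic_Cn_on F \<Omega>" "\<And>z. z \<in> \<Omega> - L \<Longrightarrow> F z = f z"
    by blast
  have "A_regular p \<Omega> F" using \<Omega> L f F by (rule A_regular_glue)
  then have "A_regular p \<Omega> (restrict F \<Omega>)"
    by (rule A_regular_cong[OF \<Omega>]) simp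
  then have "restrict F \<Omega> \<in> A_space p \<Omega>" by (simp add: A_space_eq)
  moreover have "\<forall>z\<in>\<Omega> - L. restrict F \<Omega> z = f z" using F by simp
  ultimately show "has_A_extension p \<Omega> (\<Omega> - L) f"
    unfolding has_A_extension_def by blast
qed

text \<open>
The functions \<open>F n\<close> are controlled on \<open>V - L\<close> only, but this set contains the frontier of \<open>V\<close>, so
the maximum principle carries uniform convergence across \<open>L\<close>.
\<close>

lemma holomorphic_extension_limit:
  fixes \<Omega> L V :: "(complex ^ 'n) set"
  assumes \<Omega>: "open \<Omega>" and L: "closed L"
    and V: "compact V" "L \<subseteq> interior V" "V \<subseteq> \<Omega>"
    and f: "holomorphic_Cn_on f (\<Omega> - L)" and F: "\<And>n. holomorphic_Cn_on (F n) \<Omega>"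
    and lim: "uniform_limit (V - L) F f sequentially"
  shows "\<exists>H. holomorphic_Cn_on H \<Omega> \<and> (\<forall>z\<in>\<Omega> - L. H z = f z)"
proof -
  have frontier: "frontier V \<subseteq> V - L"
    using V(1,2) by (auto simp: frontier_def compact_imp_closed closure_closed)
  have "uniformly_Cauchy_on V F"
  proof (rule uniformly_Cauchy_onI)
    fix e :: real assume e: "0 < e"
    have "uniformly_Cauchy_on (V - L) F"
      unfolding uniformly_convergent_eq_Cauchy[symmetric] uniformly_convergent_on_def
      using lim by blast
    then obtain M where M: "\<And>x m n. x \<in> V - L \<Longrightarrow> M \<le> m \<Longrightarrow> M \<le> n \<Longrightarrow> dist (F m x) (F n x) < e / 2"
      using half_gt_zero[OF e] unfolding uniformly_Cauchy_on_def by blast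
    have "dist (F m x) (F n x) < e" if x: "x \<in> V" and mn: "M \<le> m" "M \<le> n" for x m n
    proof -
      have "cmod (1 * F m x + (- 1) * F n x) \<le> e / 2"
      proof (rule maximum_modulus_Cn[OF holomorphic_Cn_on_lincomb[OF F F] V(1,3) _ x])
        fix y assume "y \<in> frontier V"
        then have "dist (F m y) (F n y) < e / 2" using M frontier mn by blast
        then show "cmod (1 * F m y + (- 1) * F n y) \<le> e / 2" by (simp add: dist_norm)
      qed
      then show ?thesis using e by (simp add: dist_norm)
    qed
    then show "\<exists>M. \<forall>x\<in>V. \<forall>m\<ge>M. \<forall>n\<ge>M. dist (F m x) (F n x) < e" by blast
  qed
  then obtain g where g: "uniform_limit V F g sequentially"
    unfolding uniformly_convergent_eq_Cauchy[symmetric] uniformly_convergent_on_def by blast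
  have gf: "g z = f z" if "z \<in> V - L" for z
    by (rule LIMSEQ_unique[OF tendsto_uniform_limitI[OF g] tendsto_uniform_limitI[OF lim that]])
      (use that in blast)
  define H where "H z = (if z \<in> L then g z else f z)" for z
  have "holomorphic_Cn_on g (interior V)"
  proof (rule holomorphic_Cn_on_uniform_limit)
    show "holomorphic_Cn_on (F n) (interior V)" for n
      by (rule holomorphic_Cn_on_subset[OF F]) (use V(3) interior_subset in blast)
    show "uniform_limit (interior V) F g sequentially"
      using g interior_subset by (rule uniform_limit_on_subset)
  qed simp
  moreover have "g z = H z" if "z \<in> interior V" for z
    using gf[of z] that interior_subset by (auto simp: H_def)
  ultimately have HV: "holomorphic_Cn_on H (interior V)"
    using open_interior by (intro holomorphic_Cn_on_cong[of "interior V" g H])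
  have HG: "holomorphic_Cn_on H (\<Omega> - L)"
    by (rule holomorphic_Cn_on_cong[OF open_Diff[OF \<Omega> L] _ f]) (simp add: H_def)
  have "holomorphic_Cn_on H \<Omega>"
  proof (rule holomorphic_Cn_on_local)
    fix z assume "z \<in> \<Omega>"
    then show "\<exists>U. z \<in> U \<and> holomorphic_Cn_on H U"
      using HV HG V(2) by (cases "z \<in> L") blast+
  qed
  then show ?thesis by (intro exI[of _ H]) (simp add: H_def)
qed

section \<open>The non-extendable functions form an open set\<close>

lemma norm_le_A_seminorm:
  assumes f: "A_regular p W f" and z: "z \<in> W" "norm z \<le> real N"
  shows "cmod (f z) \<le> A_seminorm W 0 N f"
proof -
  have "enat (multi_order (0 :: nat ^ 'a)) \<le> p"
    by (simp add: multi_order_def flip: zero_enat_def)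
  then obtain g where g: "cont_extension W (mixed_partial 0 f) g"
    using f unfolding A_regular_def by blast
  have "g z = f z" using g z by (simp add: cont_extension_def)
  then show ?thesis
    using norm_extension_le_A_seminorm[OF g _ z(2)] z(1) closure_subset by force
qed

lemma A_regular_diff:
  assumes "open W" "A_regular p W f" "A_regular p W g"
  shows "A_regular p W (\<lambda>z. f z - g z)"
  by (rule A_regular_lincomb[OF assms, of _ 1 "- 1"]) simp

lemma openin_A_seminorm_ball:
  fixes f :: "complex ^ 'n \<Rightarrow> complex"
  assumes "f \<in> A_space p W" "enat (multi_order \<alpha>) \<le> p" "0 < \<epsilon>"
  shows "openin (A_topology p W) {g \<in> A_space p W. A_seminorm W \<alpha> N (\<lambda>z. g z - f z) < \<epsilon>}"
  unfolding A_topology_def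
  by (rule topology_generated_by_Basis) (use assms in blast)

lemma A_seminorm_diff_self:
  assumes "open W" "A_regular p W f" "enat (multi_order \<alpha>) \<le> p"
  shows "A_seminorm W \<alpha> N (\<lambda>z. f z - f z) \<le> 0"
  using A_seminorm_lincomb_le[OF assms(1,2,2), of "\<lambda>z. f z - f z" 0 0 \<alpha> N] assms(3) by simp

text \<open>
If every ball around \<open>f\<close> for the seminorm with \<open>\<alpha> = 0\<close>, at a radius \<open>N\<close> for which the ball of
radius \<open>N\<close> contains \<open>V\<close>, met the extendable functions, then a sequence of them would converge
to \<open>f\<close> uniformly on \<open>V - L\<close>, and \<open>f\<close> would extend.
\<close>

lemma openin_non_extendable:
  fixes \<Omega> L :: "(complex ^ 'n) set"
  assumes \<Omega>: "open \<Omega>" and L: "compact L" "L \<subseteq> \<Omega>"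
  shows "openin (A_topology p (\<Omega> - L)) {f \<in> A_space p (\<Omega> - L). \<not> has_A_extension p \<Omega> (\<Omega> - L) f}"
proof (subst openin_subopen, rule ballI)
  define G where "G = \<Omega> - L"
  have closed: "closed L" using L compact_imp_closed by blast
  then have G: "open G" using \<Omega> by (simp add: G_def open_Diff)
  obtain V where V: "compact V" "L \<subseteq> interior V" "V \<subseteq> \<Omega>"
    using compact_neighbourhood_in_open[OF L(1) \<Omega> L(2)] .
  obtain C where C: "\<And>x. x \<in> V \<Longrightarrow> norm x \<le> C"
    using compact_imp_bounded[OF V(1)] unfolding bounded_iff by blast
  obtain N where N: "C \<le> real N" using real_arch_simple by blast
  have order0: "enat (multi_order (0 :: nat ^ 'n)) \<le> p"
    by (simp add: multi_order_def flip: zero_enat_def)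
  fix f assume "f \<in> {f \<in> A_space p (\<Omega> - L). \<not> has_A_extension p \<Omega> (\<Omega> - L) f}"
  then have f: "f \<in> A_space p G" "A_regular p G f" and nf: "\<not> has_A_extension p \<Omega> G f"
    by (auto simp: G_def A_space_eq)
  define T where "T \<epsilon> = {g \<in> A_space p G. A_seminorm G 0 N (\<lambda>z. g z - f z) < \<epsilon>}" for \<epsilon>
  have "\<exists>\<epsilon>>0. \<forall>g\<in>T \<epsilon>. \<not> has_A_extension p \<Omega> G g"
  proof (rule ccontr)
    assume "\<not> ?thesis"
    then have "\<forall>n. \<exists>g. g \<in> T (inverse (real (Suc n))) \<and> has_A_extension p \<Omega> G g"
      by (metis inverse_positive_iff_positive of_nat_0_less_iff zero_less_Suc)
    from choice[OF this] obtain g where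
      g: "\<And>n. g n \<in> T (inverse (real (Suc n)))" "\<And>n. has_A_extension p \<Omega> G (g n)"
      by blast
    have g_reg: "A_regular p G (g n)" for n
      using g(1)[of n] by (simp add: T_def A_space_eq)
    have "\<forall>n. \<exists>F. holomorphic_Cn_on F \<Omega> \<and> (\<forall>z\<in>G. F z = g n z)"
      using has_A_extension_iff[OF \<Omega> closed L(2) g_reg[unfolded G_def]] g(2) unfolding G_def by blast
    from choice[OF this] obtain F where
      F: "\<And>n. holomorphic_Cn_on (F n) \<Omega>" "\<And>n z. z \<in> G \<Longrightarrow> F n z = g n z"
      by blast
    have "uniform_limit (V - L) F f sequentially"
    proof (rule uniform_limitI)
      fix e :: real assume e: "0 < e"
      have "\<forall>\<^sub>F n in sequentially. inverse (real (Suc n)) < e"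
        using LIMSEQ_inverse_real_of_nat e by (rule order_tendstoD)
      then show "\<forall>\<^sub>F n in sequentially. \<forall>z\<in>V - L. dist (F n z) (f z) < e"
      proof eventually_elim
        case (elim n)
        show ?case
        proof
          fix z assume z: "z \<in> V - L"
          then have zG: "z \<in> G" using V by (auto simp: G_def)
          have "norm z \<le> real N" using C[of z] N z by auto
          then have "cmod (g n z - f z) \<le> A_seminorm G 0 N (\<lambda>z. g n z - f z)"
            using norm_le_A_seminorm[OF A_regular_diff[OF G g_reg f(2)] zG] by blast
          also have "\<dots> < inverse (real (Suc n))" using g(1)[of n] by (simp add: T_def)
          also note elim
          finally show "dist (F n z) (f z) < e" using F(2)[OF zG] by (simp add: dist_norm)
        qed
      qed
    qed
    moreover have "holomorphic_Cn_on f (\<Omega> - L)"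
      using f(2) by (simp add: A_regular_def G_def)
    ultimately have "\<exists>H. holomorphic_Cn_on H \<Omega> \<and> (\<forall>z\<in>\<Omega> - L. H z = f z)"
      by (intro holomorphic_extension_limit[OF \<Omega> closed V _ F(1)])
    then show False
      using nf has_A_extension_iff[OF \<Omega> closed L(2) f(2)[unfolded G_def]] by (simp add: G_def)
  qed
  then obtain \<epsilon> where \<epsilon>: "0 < \<epsilon>" "\<forall>g\<in>T \<epsilon>. \<not> has_A_extension p \<Omega> G g" by blast
  have "openin (A_topology p G) (T \<epsilon>)"
    unfolding T_def using f(1) order0 \<epsilon>(1) by (rule openin_A_seminorm_ball)
  moreover have "f \<in> T \<epsilon>"
    using A_seminorm_diff_self[OF G f(2) order0, of N] f(1) \<epsilon>(1) by (simp add: T_def)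
  moreover have "T \<epsilon> \<subseteq> {f \<in> A_space p G. \<not> has_A_extension p \<Omega> G f}"
    using \<epsilon>(2) by (auto simp: T_def)
  ultimately show "\<exists>T. openin (A_topology p (\<Omega> - L)) T \<and> f \<in> T \<and>
      T \<subseteq> {f \<in> A_space p (\<Omega> - L). \<not> has_A_extension p \<Omega> (\<Omega> - L) f}"
    unfolding G_def by blast
qed

section \<open>The non-extendable functions are dense\<close>

text \<open>
The curve \<open>t \<mapsto> f + t g\<close> is continuous from the right at \<open>0\<close>. It suffices to test this on the
sets generating the topology, where it follows from the triangle inequality for the seminorm.
\<close>

lemma openin_A_topology_direction:
  assumes W: "open W" and T: "openin (A_topology p W) T" and f: "f \<in> T" and g: "A_regular p W g"
  shows "\<forall>\<^sub>F t in at_right 0. restrict (\<lambda>z. f z + complex_of_real t * g z) W \<in> T"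
proof -
  let ?u = "\<lambda>t. restrict (\<lambda>z. f z + complex_of_real t * g z) W"
  from T have "generate_topology_on {{g \<in> A_space p W. A_seminorm W \<alpha> N (\<lambda>z. g z - f z) < \<epsilon>} | f \<alpha> N \<epsilon>.
      f \<in> A_space p W \<and> enat (multi_order \<alpha>) \<le> p \<and> 0 < \<epsilon>} T"
    unfolding A_topology_def by (rule openin_topology_generated_by)
  then show ?thesis using f
  proof induction
    case (Int A B)
    then have "\<forall>\<^sub>F t in at_right 0. ?u t \<in> A" "\<forall>\<^sub>F t in at_right 0. ?u t \<in> B"
      by blast+
    then show ?case by eventually_elim blast
  next
    case (UN K)
    then obtain k where k: "k \<in> K" "f \<in> k" by blast
    have "\<forall>\<^sub>F t in at_right 0. ?u t \<in> k" using UN.IH[OF k] .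
    then show ?case by eventually_elim (use k in blast)
  next
    case (Basis S)
    then obtain c \<alpha> N \<epsilon> where S: "S = {g \<in> A_space p W. A_seminorm W \<alpha> N (\<lambda>z. g z - c z) < \<epsilon>}"
      and c: "c \<in> A_space p W" and \<alpha>: "enat (multi_order \<alpha>) \<le> p" by blast
    have reg: "A_regular p W f" "A_regular p W c"
      using Basis(2) c by (auto simp: S A_space_eq)
    let ?a = "A_seminorm W \<alpha> N (\<lambda>z. f z - c z)" and ?b = "A_seminorm W \<alpha> N g"
    have "((\<lambda>t. ?a + t * ?b) \<longlongrightarrow> ?a + 0 * ?b) (at_right 0)"
      by (intro tendsto_intros)
    moreover have "?a + 0 * ?b < \<epsilon>" using Basis(2) by (simp add: S)
    ultimately have "\<forall>\<^sub>F t in at_right 0. ?a + t * ?b < \<epsilon>" by (rule order_tendstoD)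
    moreover have "\<forall>\<^sub>F t :: real in at_right 0. 0 < t" by (rule eventually_at_right_less)
    ultimately show ?case
    proof eventually_elim
      case (elim t)
      have "A_regular p W (?u t)"
        by (rule A_regular_lincomb[OF W reg(1) g, of _ 1 "complex_of_real t"]) simp
      then have "?u t \<in> A_space p W" by (simp add: A_space_eq)
      moreover have "A_seminorm W \<alpha> N (\<lambda>z. ?u t z - c z) \<le> cmod 1 * ?a + cmod (complex_of_real t) * ?b"
        by (rule A_seminorm_lincomb_le[OF W A_regular_diff[OF W reg] g _ \<alpha>]) simp
      ultimately show ?case using elim by (simp add: S del: restrict_apply)
    qed
  qed simp
qed

text \<open>
The extendable functions form a linear subspace; in terms of elements, \<open>g = (h - f) / t\<close>.
\<close>

lemma has_A_extension_cancel:
  assumes \<Omega>: "open \<Omega>" and G: "G \<subseteq> \<Omega>" and f: "has_A_extension p \<Omega> G f"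
    and h: "has_A_extension p \<Omega> G h" and h_eq: "\<And>z. z \<in> G \<Longrightarrow> h z = f z + t * g z" and t: "t \<noteq> 0"
  shows "has_A_extension p \<Omega> G g"
proof -
  obtain F H where F: "A_regular p \<Omega> F" "\<And>z. z \<in> G \<Longrightarrow> F z = f z"
    and H: "A_regular p \<Omega> H" "\<And>z. z \<in> G \<Longrightarrow> H z = h z"
    using f h unfolding has_A_extension_def A_space_eq by blast
  let ?E = "restrict (\<lambda>z. (H z - F z) / t) \<Omega>"
  have "A_regular p \<Omega> ?E"
    by (rule A_regular_lincomb[OF \<Omega> H(1) F(1), of _ "1 / t" "- 1 / t"]) (simp add: diff_divide_distrib)
  then have "?E \<in> A_space p \<Omega>" by (simp add: A_space_eq)
  moreover have "?E z = g z" if "z \<in> G" for z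
    using that G t F(2)[OF that] H(2)[OF that] h_eq[OF that] by auto
  ultimately show ?thesis unfolding has_A_extension_def by blast
qed

lemma non_extendable_dense:
  assumes \<Omega>: "open \<Omega>" and G: "open G" "G \<subseteq> \<Omega>"
    and f0: "f\<^sub>0 \<in> A_space p G" "\<not> has_A_extension p \<Omega> G f\<^sub>0"
  shows "A_topology p G closure_of {f \<in> A_space p G. \<not> has_A_extension p \<Omega> G f} = A_space p G"
proof
  show "A_topology p G closure_of {f \<in> A_space p G. \<not> has_A_extension p \<Omega> G f} \<subseteq> A_space p G"
    using closure_of_subset_topspace topspace_A_topology by metis
  show "A_space p G \<subseteq> A_topology p G closure_of {f \<in> A_space p G. \<not> has_A_extension p \<Omega> G f}"
  proof
    fix f assume f: "f \<in> A_space p G"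
    have "\<exists>h. h \<in> {f \<in> A_space p G. \<not> has_A_extension p \<Omega> G f} \<and> h \<in> T"
      if T: "f \<in> T" "openin (A_topology p G) T" for T
    proof (cases "has_A_extension p \<Omega> G f")
      case True
      have "\<forall>\<^sub>F t in at_right 0. restrict (\<lambda>z. f z + complex_of_real t * f\<^sub>0 z) G \<in> T"
        using f0(1) by (intro openin_A_topology_direction[OF G(1) T(2,1)]) (simp add: A_space_eq)
      moreover have "\<forall>\<^sub>F t :: real in at_right 0. 0 < t" by (rule eventually_at_right_less)
      ultimately have "\<forall>\<^sub>F t in at_right 0. restrict (\<lambda>z. f z + complex_of_real t * f\<^sub>0 z) G \<in> T \<and> 0 < t"
        by (rule eventually_conj)
      then obtain t where t: "restrict (\<lambda>z. f z + complex_of_real t * f\<^sub>0 z) G \<in> T" "0 < t"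
        using eventually_happens trivial_limit_at_right_real by blast
      let ?h = "restrict (\<lambda>z. f z + complex_of_real t * f\<^sub>0 z) G"
      have "\<not> has_A_extension p \<Omega> G ?h"
      proof
        assume "has_A_extension p \<Omega> G ?h"
        then have "has_A_extension p \<Omega> G f\<^sub>0"
          by (rule has_A_extension_cancel[OF \<Omega> G(2) True, where t = "complex_of_real t"]) (use t in auto)
        then show False using f0(2) by blast
      qed
      moreover have "?h \<in> A_space p G"
        using t(1) openin_subset[OF T(2)] topspace_A_topology by blast
      ultimately show ?thesis using t(1) by blast
    qed (use f T in blast)
    then show "f \<in> A_topology p G closure_of {f \<in> A_space p G. \<not> has_A_extension p \<Omega> G f}"
      unfolding in_closure_of topspace_A_topology using f by blast
  qed
qed

theorem theorem6:
  fixes p :: enat and \<Omega> L G :: "(complex ^ 'n) set"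
  assumes "open \<Omega>" and "compact L" and "L \<subseteq> \<Omega>" and "G = \<Omega> - L"
    and "\<exists>f\<^sub>0\<in>A_space p G. \<not> has_A_extension p \<Omega> G f\<^sub>0"
  shows "gdelta_in (A_topology p G) {f \<in> A_space p G. \<not> has_A_extension p \<Omega> G f} \<and>
    A_topology p G closure_of {f \<in> A_space p G. \<not> has_A_extension p \<Omega> G f} = A_space p G"
proof
  show "gdelta_in (A_topology p G) {f \<in> A_space p G. \<not> has_A_extension p \<Omega> G f}"
    unfolding \<open>G = \<Omega> - L\<close> using assms(1-3) by (intro open_imp_gdelta_in openin_non_extendable)
  have "open G" "G \<subseteq> \<Omega>"
    using assms by (auto simp: compact_imp_closed open_Diff)
  then show "A_topology p G closure_of {f \<in> A_space p G. \<not> has_A_extension p \<Omega> G f} = A_space p G"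
    using assms(1,5) non_extendable_dense by blast
qed

end
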